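(* Let $I=[x_0,x_N]$ be any compact interval with partition $\Delta: x_0<x_1<\dots<x_N$, $N\ge 2$, and let $\alpha=(\alpha_1,\dots,\alpha_N)$ be a scale vector, i.e. $|\alpha_i|<1$ for all $i$. Let $f^\alpha$ be the $\alpha$-fractal function of $f\in\mathcal C(I)$ with base function $b\in\mathcal C(I)$ (so $b(x_0)=f(x_0)$, $b(x_N)=f(x_N)$) and partition $\Delta$, and let $f_F^{\alpha_F}$ be the corresponding flipped $\alpha$-fractal function of $f$ on $I_F=[-x_N,-x_0]$. Then $$\int_{-x_N}^{-x_0} f_F^{\alpha_F}(x)\,dx=\int_{x_0}^{x_N} f^\alpha(x)\,dx.$$
   Context: $\mathcal C(J)$ is the space of continuous real-valued functions on a compact interval $J$. Let $N\ge2$, let $\Delta:x_0<x_1<\dots<x_N$ be a partition of $I=[x_0,x_N]$, and set $I_i=[x_{i-1},x_i]$ for $i=1,\dots,N$. Let $L_i:I\to I_i$, $L_i(x)=a_ix+e_i$, with $a_i=\frac{x_i-x_{i-1}}{x_N-x_0}$ and $e_i=\frac{x_Nx_{i-1}-x_0x_i}{x_N-x_0}$, so $L_i(x_0)=x_{i-1}$ and $L_i(x_N)=x_i$. A scale vector is $\alpha=(\alpha_1,\dots,\alpha_N)\in\mathbb R^N$ with $|\alpha_i|<1$ for all $i$. A base function for $f\in\mathcal C(I)$ is a function $b\in\mathcal C(I)$ with $b(x_0)=f(x_0)$ and $b(x_N)=f(x_N)$. The $\alpha$-fractal function $f^\alpha$ of $f$ with base function $b$ and partition $\Delta$ is the continuous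 function on $I$ whose graph is the attractor of the iterated function system $W_i(x,y)=(L_i(x),\ \alpha_i y+f(L_i(x))-\alpha_i b(x))$, $i=1,\dots,N$, on $I\times\mathbb R$; equivalently, it is the unique function in $\mathcal C(I)$ satisfying $f^\alpha(x)=f(x)+\alpha_i\,(f^\alpha-b)(L_i^{-1}(x))$ for all $x\in I_i$, $i=1,\dots,N$. Flipped objects: $I_F=[-x_N,-x_0]$ with partition $\Delta_F:-x_N<-x_{N-1}<\dots<-x_0$ and subintervals $I_{Fi}=[-x_{N+1-i},-x_{N-i}]$, $i=1,\dots,N$; $f_F,b_F\in\mathcal C(I_F)$ are defined by $f_F(x)=f(-x)$, $b_F(x)=b(-x)$ for $x\in I_F$; $\alpha_F=(\alpha_N,\alpha_{N-1},\dots,\alpha_1)$; and $L_{Fi}:I_F\to I_{Fi}$ is $L_{Fi}(x)=a_{N+1-i}x-e_{N+1-i}$. The flipped $\alpha$-fractal function $f_F^{\alpha_F}$ of $f$ is the $\alpha_F$-fractal function of $f_F$ with base function $b_F$ and partition $\Delta_F$, i.e. the unique function in $\mathcal C(I_F)$ satisfying $f_F^{\alpha_F}(x)=f_F(x)+\alpha_{N+1-i}\,(f_F^{\alpha_F}-b_F)(L_{Fi}^{-1}(x))$ for all $x\in I_{Fi}$, $i=1,\dots,N$. *)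

theory Defs
  imports "HOL-Analysis.Analysis"
begin

text \<open>
  A partition \<open>x 0 < \<dots> < x N\<close> is a sequence of which only the entries \<open>0..N\<close> matter, a scale
  vector is a sequence of which only the entries \<open>1..N\<close> matter, and a function on the interval
  \<open>{x 0..x N}\<close> is represented by a function on \<open>real\<close> of which only the values on the interval matter.
\<close>

definition is_partition :: "nat \<Rightarrow> (nat \<Rightarrow> real) \<Rightarrow> bool" where
  "is_partition N x \<longleftrightarrow> strict_mono_on {0..N} x"

definition scale_vector :: "nat \<Rightarrow> (nat \<Rightarrow> real) \<Rightarrow> bool" where
  "scale_vector N \<alpha> \<longleftrightarrow> (\<forall>i\<in>{1..N}. \<bar>\<alpha> i\<bar> < 1)"

definition base_function ::
    "nat \<Rightarrow> (nat \<Rightarrow> real) \<Rightarrow> (real \<Rightarrow> real) \<Rightarrow> (real \<Rightarrow> real) \<Rightarrow> bool" where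
  "base_function N x f b \<longleftrightarrow>
     continuous_on {x 0..x N} b \<and> b (x 0) = f (x 0) \<and> b (x N) = f (x N)"

definition slope :: "nat \<Rightarrow> (nat \<Rightarrow> real) \<Rightarrow> nat \<Rightarrow> real" where
  "slope N x i = (x i - x (i - 1)) / (x N - x 0)"

definition intercept :: "nat \<Rightarrow> (nat \<Rightarrow> real) \<Rightarrow> nat \<Rightarrow> real" where
  "intercept N x i = (x N * x (i - 1) - x 0 * x i) / (x N - x 0)"

definition Lmap :: "nat \<Rightarrow> (nat \<Rightarrow> real) \<Rightarrow> nat \<Rightarrow> real \<Rightarrow> real" where
  "Lmap N x i t = slope N x i * t + intercept N x i"

definition self_referential ::
    "nat \<Rightarrow> (nat \<Rightarrow> real) \<Rightarrow> (nat \<Rightarrow> real) \<Rightarrow> (real \<Rightarrow> real) \<Rightarrow> (real \<Rightarrow> real) \<Rightarrow> (real \<Rightarrow> real) \<Rightarrow> bool" where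
  "self_referential N x \<alpha> f b g \<longleftrightarrow>
     (\<forall>i\<in>{1..N}. \<forall>t\<in>{x (i - 1)..x i}.
        g t = f t + \<alpha> i * (g (inv_into {x 0..x N} (Lmap N x i) t) - b (inv_into {x 0..x N} (Lmap N x i) t)))"

text \<open>
  Extensionality (the value \<open>undefined\<close> outside the interval) makes the unique element of
  \<open>C {x 0..x N}\<close> a unique function on \<open>real\<close>.  The description is proper by
  \<open>fractal_function_ex1\<close> below, and \<open>is_attractor_iff\<close> identifies the graph of the
  function as the attractor of the iterated function system.
\<close>

definition fractal_function ::
    "nat \<Rightarrow> (nat \<Rightarrow> real) \<Rightarrow> (nat \<Rightarrow> real) \<Rightarrow> (real \<Rightarrow> real) \<Rightarrow> (real \<Rightarrow> real) \<Rightarrow> real \<Rightarrow> real" where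
  "fractal_function N x \<alpha> f b =
     (THE g. g \<in> extensional {x 0..x N} \<and> continuous_on {x 0..x N} g \<and> self_referential N x \<alpha> f b g)"

definition flip_partition :: "nat \<Rightarrow> (nat \<Rightarrow> real) \<Rightarrow> nat \<Rightarrow> real" where
  "flip_partition N x i = - x (N - i)"

definition flip_scale :: "nat \<Rightarrow> (nat \<Rightarrow> real) \<Rightarrow> nat \<Rightarrow> real" where
  "flip_scale N \<alpha> i = \<alpha> (N + 1 - i)"

definition flip_function :: "(real \<Rightarrow> real) \<Rightarrow> real \<Rightarrow> real" where
  "flip_function f t = f (- t)"

definition flipped_fractal_function ::
    "nat \<Rightarrow> (nat \<Rightarrow> real) \<Rightarrow> (nat \<Rightarrow> real) \<Rightarrow> (real \<Rightarrow> real) \<Rightarrow> (real \<Rightarrow> real) \<Rightarrow> real \<Rightarrow> real" where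
  "flipped_fractal_function N x \<alpha> f b =
     fractal_function N (flip_partition N x) (flip_scale N \<alpha>) (flip_function f) (flip_function b)"

text \<open>
  The attractor is the unique nonempty compact set that is mapped to itself; that it is unique is
  part of \<open>is_attractor_iff\<close>.
\<close>

definition ifs_map ::
    "nat \<Rightarrow> (nat \<Rightarrow> real) \<Rightarrow> (nat \<Rightarrow> real) \<Rightarrow> (real \<Rightarrow> real) \<Rightarrow> (real \<Rightarrow> real) \<Rightarrow> nat \<Rightarrow> real \<times> real \<Rightarrow> real \<times> real" where
  "ifs_map N x \<alpha> f b i = (\<lambda>(t, y). (Lmap N x i t, \<alpha> i * y + f (Lmap N x i t) - \<alpha> i * b t))"

definition is_attractor ::
    "nat \<Rightarrow> (nat \<Rightarrow> real) \<Rightarrow> (nat \<Rightarrow> real) \<Rightarrow> (real \<Rightarrow> real) \<Rightarrow> (real \<Rightarrow> real) \<Rightarrow> (real \<times> real) set \<Rightarrow> bool" where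
  "is_attractor N x \<alpha> f b A \<longleftrightarrow>
     A \<noteq> {} \<and> compact A \<and> A \<subseteq> {x 0..x N} \<times> UNIV \<and> A = (\<Union>i\<in>{1..N}. ifs_map N x \<alpha> f b i ` A)"

lemma Lmap_flip_partition:
  assumes "i \<in> {1..N}"
  shows "Lmap N (flip_partition N x) i t = slope N x (N + 1 - i) * t - intercept N x (N + 1 - i)"
proof -
  have e: "N - (i - 1) = N + 1 - i" "N + 1 - i - 1 = N - i" using assms by auto
  show ?thesis
    unfolding Lmap_def slope_def intercept_def flip_partition_def e
    by (simp add: minus_divide_left)
qed

context
  fixes N :: nat and x :: "nat \<Rightarrow> real"
  assumes N: "2 \<le> N" and part: "is_partition N x"
begin

lemma partition_less: "i < j \<Longrightarrow> j \<le> N \<Longrightarrow> x i < x j"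
  using part by (auto simp: is_partition_def intro: strict_mono_onD)

lemma partition_le: "i \<le> j \<Longrightarrow> j \<le> N \<Longrightarrow> x i \<le> x j"
  using partition_less[of i j] by (cases "i = j") auto

lemma partition_ends: "x 0 < x N"
  using partition_less[of 0 N] N by simp

lemma subinterval_subset: "i \<in> {1..N} \<Longrightarrow> {x (i - 1)..x i} \<subseteq> {x 0..x N}"
  using partition_le[of 0 "i - 1"] partition_le[of i N] by auto

lemma subinterval_cover:
  assumes "t \<in> {x 0..x N}"
  obtains i where "i \<in> {1..N}" "t \<in> {x (i - 1)..x i}"
proof -
  define i where "i = (LEAST i. 1 \<le> i \<and> t \<le> x i)"
  have ex: "1 \<le> N \<and> t \<le> x N" using assms N by auto
  have i: "1 \<le> i" "t \<le> x i" using LeastI[of "\<lambda>i. 1 \<le> i \<and> t \<le> x i", OF ex] by (auto simp: i_def)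
  have iN: "i \<le> N" unfolding i_def using ex by (rule Least_le)
  have "x (i - 1) \<le> t"
  proof (cases "i = 1")
    case False
    then have "\<not> (1 \<le> i - 1 \<and> t \<le> x (i - 1))"
      using i(1) not_less_Least[of "i - 1" "\<lambda>i. 1 \<le> i \<and> t \<le> x i"] by (auto simp: i_def)
    then show ?thesis using False i by auto
  qed (use assms in auto)
  then show ?thesis using i iN by (intro that[of i]) auto
qed

lemma slope_pos: "i \<in> {1..N} \<Longrightarrow> 0 < slope N x i"
  using partition_less[of "i - 1" i] partition_ends by (auto simp: slope_def)

lemma slope_less_1:
  assumes "i \<in> {1..N}"
  shows "slope N x i < 1"
proof -
  have "x i - x (i - 1) < x N - x 0"
  proof (cases "i = 1")
    case True
    then show ?thesis using partition_less[of 1 N] N by auto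
  next
    case False
    then have "x 0 < x (i - 1)" using assms by (intro partition_less) auto
    moreover have "x i \<le> x N" using assms by (intro partition_le) auto
    ultimately show ?thesis by simp
  qed
  then show ?thesis using partition_ends by (simp add: slope_def)
qed

lemma Lmap_eq: "Lmap N x i t = x (i - 1) + slope N x i * (t - x 0)"
proof -
  have "x N - x 0 \<noteq> 0" using partition_ends by simp
  then have "intercept N x i = x (i - 1) - slope N x i * x 0"
    by (simp add: intercept_def slope_def field_simps)
  then show ?thesis by (simp add: Lmap_def algebra_simps)
qed

lemma Lmap_ends: "Lmap N x i (x 0) = x (i - 1)" "Lmap N x i (x N) = x i"
  using partition_ends by (simp_all add: Lmap_eq) (simp add: slope_def)

lemma Lmap_inverse:
  assumes "i \<in> {1..N}"
  shows "Lmap N x i t = s \<longleftrightarrow> t = x 0 + (s - x (i - 1)) / slope N x i"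
  using slope_pos[OF assms] by (auto simp: Lmap_eq field_simps)

lemma Lmap_le_iff:
  assumes "i \<in> {1..N}"
  shows "Lmap N x i s \<le> Lmap N x i t \<longleftrightarrow> s \<le> t"
  using slope_pos[OF assms] by (simp add: Lmap_eq)

lemma bij_betw_Lmap:
  assumes i: "i \<in> {1..N}"
  shows "bij_betw (Lmap N x i) {x 0..x N} {x (i - 1)..x i}"
proof (rule bij_betw_imageI)
  show "inj_on (Lmap N x i) {x 0..x N}"
    using Lmap_inverse[OF i] by (metis inj_onI)
  have "s \<in> Lmap N x i ` {x 0..x N}" if s: "s \<in> {x (i - 1)..x i}" for s
  proof -
    obtain t where t: "Lmap N x i t = s" using Lmap_inverse[OF i] by metis
    then have "t \<in> {x 0..x N}"
      using s Lmap_le_iff[OF i, of "x 0" t] Lmap_le_iff[OF i, of t "x N"] by (auto simp: Lmap_ends)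
    then show ?thesis using t by blast
  qed
  moreover have "Lmap N x i t \<in> {x (i - 1)..x i}" if "t \<in> {x 0..x N}" for t
    using that Lmap_le_iff[OF i, of "x 0" t] Lmap_le_iff[OF i, of t "x N"] by (auto simp: Lmap_ends)
  ultimately show "Lmap N x i ` {x 0..x N} = {x (i - 1)..x i}" by blast
qed

lemma self_referential_iff:
  "self_referential N x \<alpha> f b g \<longleftrightarrow>
     (\<forall>i\<in>{1..N}. \<forall>t\<in>{x 0..x N}. g (Lmap N x i t) = f (Lmap N x i t) + \<alpha> i * (g t - b t))"
proof -
  have "(\<forall>t\<in>{x (i - 1)..x i}. g t = f t + \<alpha> i *
          (g (inv_into {x 0..x N} (Lmap N x i) t) - b (inv_into {x 0..x N} (Lmap N x i) t))) \<longleftrightarrow>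
        (\<forall>t\<in>{x 0..x N}. g (Lmap N x i t) = f (Lmap N x i t) + \<alpha> i * (g t - b t))"
    if i: "i \<in> {1..N}" for i
  proof -
    note b = bij_betw_Lmap[OF i]
    have "{x (i - 1)..x i} = Lmap N x i ` {x 0..x N}" using b by (simp add: bij_betw_def)
    then show ?thesis using bij_betw_inv_into_left[OF b] by simp
  qed
  then show ?thesis unfolding self_referential_def by blast
qed

lemma self_referential_unique:
  assumes \<alpha>: "scale_vector N \<alpha>"
    and g: "continuous_on {x 0..x N} g" "self_referential N x \<alpha> f b g"
    and h: "continuous_on {x 0..x N} h" "self_referential N x \<alpha> f b h"
    and "t \<in> {x 0..x N}"
  shows "g t = h t"
proof -
  have "continuous_on {x 0..x N} (\<lambda>t. \<bar>g t - h t\<bar>)" using g h by (intro continuous_intros)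
  then obtain s where s: "s \<in> {x 0..x N}" "\<And>t. t \<in> {x 0..x N} \<Longrightarrow> \<bar>g t - h t\<bar> \<le> \<bar>g s - h s\<bar>"
    using continuous_attains_sup[of "{x 0..x N}" "\<lambda>t. \<bar>g t - h t\<bar>"] partition_ends by auto
  obtain i where i: "i \<in> {1..N}" "s \<in> {x (i - 1)..x i}" using subinterval_cover[OF s(1)] .
  obtain r where r: "r \<in> {x 0..x N}" "s = Lmap N x i r"
    using i(2) bij_betw_imp_surj_on[OF bij_betw_Lmap[OF i(1)]] by blast
  have "g s = f s + \<alpha> i * (g r - b r)" "h s = f s + \<alpha> i * (h r - b r)"
    using g(2) h(2) i(1) r unfolding self_referential_iff by blast+
  then have "g s - h s = \<alpha> i * (g r - h r)" by (simp add: algebra_simps)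
  then have "\<bar>g s - h s\<bar> \<le> \<bar>\<alpha> i\<bar> * \<bar>g s - h s\<bar>"
    using s(2)[OF r(1)] by (simp add: abs_mult mult_left_mono)
  moreover have "\<bar>\<alpha> i\<bar> < 1" using \<alpha> i(1) by (simp add: scale_vector_def)
  ultimately have "\<bar>g s - h s\<bar> = 0"
    using mult_strict_right_mono[of "\<bar>\<alpha> i\<bar>" 1 "\<bar>g s - h s\<bar>"] by (cases "g s = h s") auto
  then show ?thesis using s(2)[OF \<open>t \<in> {x 0..x N}\<close>] by simp
qed

lemma self_referential_exists:
  assumes \<alpha>: "scale_vector N \<alpha>"
    and f: "continuous_on {x 0..x N} f" and base: "base_function N x f b"
  obtains g where "continuous_on {x 0..x N} g" "self_referential N x \<alpha> f b g"
proof -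
  define k where "k s = max (x 0) (min (x N) s)" for s
  define M where "M i s = k (x 0 + (s - x (i - 1)) / slope N x i)" for i s
  define T0 where "T0 u s = f (k s) - b (k s) + (\<Sum>i=1..N. \<alpha> i * u (M i s))" for u :: "real \<Rightarrow> real" and s
  define S where "S = PiC {x 0, x N} (\<lambda>_. {0::real})"
  define c where "c = Max ((\<lambda>i. \<bar>\<alpha> i\<bar>) ` {1..N})"
  have k_in: "k s \<in> {x 0..x N}" for s using partition_ends by (auto simp: k_def)
  have k_id: "k s = s" if "s \<in> {x 0..x N}" for s using that by (auto simp: k_def)
  have k_idem: "k (k s) = k s" for s using k_id k_in .
  have M_in: "M i s \<in> {x 0..x N}" for i s by (simp add: M_def k_in del: atLeastAtMost_iff)
  have M_low: "M i s = x 0" if "i \<in> {1..N}" "s \<le> x (i - 1)" for i s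
  proof -
    have "(s - x (i - 1)) / slope N x i \<le> 0"
      using that slope_pos[OF that(1)] by (simp add: divide_nonpos_pos)
    then show ?thesis using partition_ends by (auto simp: M_def k_def)
  qed
  have M_high: "M i s = x N" if i: "i \<in> {1..N}" "x i \<le> s" for i s
  proof -
    have "x N = x 0 + (x i - x (i - 1)) / slope N x i"
      using Lmap_inverse[OF i(1), of "x N" "x i"] by (simp add: Lmap_ends)
    also have "\<dots> \<le> x 0 + (s - x (i - 1)) / slope N x i"
      using i slope_pos[OF i(1)] by (simp add: divide_right_mono)
    finally show ?thesis using partition_ends by (auto simp: M_def k_def)
  qed
  have M_L: "M i (Lmap N x i t) = t" if "i \<in> {1..N}" "t \<in> {x 0..x N}" for i t
    using that Lmap_inverse[OF that(1), of t "Lmap N x i t"] k_id[OF that(2)] by (simp add: M_def)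
  have fb: "continuous_on {x 0..x N} (\<lambda>s. f s - b s)"
    using f base by (auto simp: base_function_def intro: continuous_intros)
  have k_cont: "continuous_on UNIV k"
    unfolding k_def by (intro continuous_intros)
  have fbk: "continuous_on UNIV (\<lambda>s. f (k s) - b (k s))"
    using continuous_on_compose2[OF fb k_cont] k_in by blast
  have M_cont: "continuous_on UNIV (M i)" if i: "i \<in> {1..N}" for i
    unfolding M_def
    by (rule continuous_on_compose2[OF k_cont]) (use slope_pos[OF i] in \<open>auto intro!: continuous_intros\<close>)
  have single: "(\<Sum>j=1..N. \<alpha> j * u (M j s)) = \<alpha> i * u (M i s)"
    if u: "u (x 0) = 0" "u (x N) = 0" and i: "i \<in> {1..N}" "s \<in> {x (i - 1)..x i}"
    for u :: "real \<Rightarrow> real" and i s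
  proof -
    have "\<alpha> j * u (M j s) = 0" if j: "j \<in> {1..N} - {i}" for j
    proof (cases "j < i")
      case True
      then have "x j \<le> x (i - 1)" using i by (intro partition_le) auto
      then have "x j \<le> s" using i by simp
      then show ?thesis using M_high[of j s] j u by auto
    next
      case False
      then have "x i \<le> x (j - 1)" using i j by (intro partition_le) auto
      then have "s \<le> x (j - 1)" using i by simp
      then show ?thesis using M_low[of j s] j u by auto
    qed
    then have "(\<Sum>j=1..N. \<alpha> j * u (M j s)) = (\<Sum>j\<in>{i}. \<alpha> j * u (M j s))"
      using i by (intro sum.mono_neutral_right) auto
    then show ?thesis by simp
  qed
  have T0_k: "T0 u s = T0 u (k s)" if u: "u (x 0) = 0" "u (x N) = 0" for u s
  proof (cases "s \<in> {x 0..x N}")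
    case True
    then show ?thesis by (simp add: k_id del: atLeastAtMost_iff)
  next
    case False
    have M_k: "u (M i s) = u (M i (k s))" if i: "i \<in> {1..N}" for i
    proof (cases "s < x 0")
      case True
      then have "k s = x 0" using partition_ends by (auto simp: k_def)
      moreover have "x 0 \<le> x (i - 1)" using partition_le[of 0 "i - 1"] i by auto
      ultimately show ?thesis using M_low[OF i, of s] M_low[OF i, of "x 0"] True by simp
    next
      case F: False
      then have "x N < s" using False by auto
      then have "k s = x N" using partition_ends by (auto simp: k_def)
      moreover have "x i \<le> x N" using partition_le[of i N] i by auto
      ultimately show ?thesis using M_high[OF i, of s] M_high[OF i, of "x N"] \<open>x N < s\<close> by simp
    qed
    then show ?thesis by (simp add: T0_def k_idem)
  qed
  have T0_cont: "continuous_on UNIV (T0 u)" if "continuous_on UNIV u" for u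
    unfolding T0_def
    by (intro continuous_intros fbk continuous_on_compose2[OF that M_cont]) auto
  have T0_bcont: "T0 (apply_bcontfun u) \<in> bcontfun" if "u \<in> S" for u
  proof -
    have u: "apply_bcontfun u (x 0) = 0" "apply_bcontfun u (x N) = 0"
      using that by (auto simp: S_def mem_PiC_iff)
    have cont: "continuous_on UNIV (T0 u)" by (intro T0_cont) simp
    then have "compact (T0 u ` {x 0..x N})"
      by (intro compact_continuous_image compact_Icc) (auto intro: continuous_on_subset)
    moreover have "range (T0 u) \<subseteq> T0 u ` {x 0..x N}"
      using T0_k[of u] u k_in by (auto simp del: atLeastAtMost_iff)
    ultimately have "bounded (range (T0 u))" using compact_imp_bounded bounded_subset by blast
    then show ?thesis using cont by (simp add: bcontfun_def)
  qed
  define T where "T u = Bcontfun (T0 (apply_bcontfun u))" for u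
  have T_apply: "apply_bcontfun (T u) = T0 u" if "u \<in> S" for u
    using T0_bcont[OF that] by (simp add: T_def Bcontfun_inverse)
  have T_L: "T0 u (Lmap N x i t) = f (Lmap N x i t) - b (Lmap N x i t) + \<alpha> i * u t"
    if u: "u (x 0) = 0" "u (x N) = 0" and it: "i \<in> {1..N}" "t \<in> {x 0..x N}" for u i t
  proof -
    have in1: "Lmap N x i t \<in> {x (i - 1)..x i}" using bij_betw_apply[OF bij_betw_Lmap[OF it(1)] it(2)] .
    then have "Lmap N x i t \<in> {x 0..x N}" using subinterval_subset[OF it(1)] by blast
    then show ?thesis
      using single[OF u it(1) in1] M_L[OF it] by (simp add: T0_def k_id)
  qed
  have S0: "apply_bcontfun u (x 0) = 0" "apply_bcontfun u (x N) = 0" if "u \<in> S" for u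
    using that by (auto simp: S_def mem_PiC_iff)
  have c1: "c < 1" and c0: "0 \<le> c" and c_ge: "\<And>i. i \<in> {1..N} \<Longrightarrow> \<bar>\<alpha> i\<bar> \<le> c"
  proof -
    show "\<And>i. i \<in> {1..N} \<Longrightarrow> \<bar>\<alpha> i\<bar> \<le> c" unfolding c_def by (intro Max_ge) auto
    from this[of 1] show "0 \<le> c" using N by simp
    show "c < 1" unfolding c_def using \<alpha> N by (subst Max_less_iff) (auto simp: scale_vector_def)
  qed
  have "\<exists>!u. u \<in> S \<and> T u = u"
  proof (rule Banach_fix[OF _ _ c0 c1])
    show "complete S" unfolding S_def complete_eq_closed by (intro closed_PiC) auto
    show "S \<noteq> {}" using mem_PiC_iff[of "const_bcontfun 0" "{x 0, x N}" "\<lambda>_. {0::real}"]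
      by (auto simp: S_def const_bcontfun.rep_eq)
    show "T ` S \<subseteq> S"
    proof safe
      fix u assume u: "u \<in> S"
      have "T0 u (x 0) = 0"
        using T_L[OF S0[OF u], of 1 "x 0"] S0[OF u] N base partition_ends
        by (simp add: Lmap_ends base_function_def)
      moreover have "T0 u (x N) = 0"
        using T_L[OF S0[OF u], of N "x N"] S0[OF u] N base partition_ends
        by (simp add: Lmap_ends base_function_def)
      ultimately show "T u \<in> S" using T_apply[OF u] by (simp add: S_def mem_PiC_iff)
    qed
    show "dist (T u) (T v) \<le> c * dist u v" if uv: "u \<in> S" "v \<in> S" for u v
    proof (rule dist_bound)
      fix s
      obtain i where i: "i \<in> {1..N}" "k s \<in> {x (i - 1)..x i}" using subinterval_cover[OF k_in[of s]] .
      obtain r where r: "r \<in> {x 0..x N}" "k s = Lmap N x i r"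
        using i(2) bij_betw_imp_surj_on[OF bij_betw_Lmap[OF i(1)]] by blast
      have "dist (T u s) (T v s) = \<bar>T0 u (k s) - T0 v (k s)\<bar>"
        using T_apply uv T0_k[OF S0[OF uv(1)], of s] T0_k[OF S0[OF uv(2)], of s]
        by (simp add: dist_real_def)
      also have "T0 u (k s) - T0 v (k s) = \<alpha> i * (u r - v r)"
        using T_L[OF S0[OF uv(1)] i(1) r(1)] T_L[OF S0[OF uv(2)] i(1) r(1)] r(2)
        by (simp add: algebra_simps)
      also have "\<bar>\<alpha> i * (u r - v r)\<bar> = \<bar>\<alpha> i\<bar> * dist (u r) (v r)" by (simp add: abs_mult dist_real_def)
      also have "\<dots> \<le> c * dist u v" using c_ge[OF i(1)] c0 by (intro mult_mono dist_bounded) auto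
      finally show "dist (T u s) (T v s) \<le> c * dist u v" .
    qed
  qed
  then obtain u where u: "u \<in> S" "T u = u" by blast
  have "T0 u = u" using T_apply[OF u(1)] u(2) by simp
  show ?thesis
  proof (rule that)
    show "continuous_on {x 0..x N} (\<lambda>t. u t + b t)"
      using base by (auto simp: base_function_def intro!: continuous_intros)
    show "self_referential N x \<alpha> f b (\<lambda>t. u t + b t)"
      using T_L[OF S0[OF u(1)]] \<open>T0 u = u\<close> by (simp add: self_referential_iff)
  qed
qed

lemma fractal_function_ex1:
  assumes \<alpha>: "scale_vector N \<alpha>"
    and f: "continuous_on {x 0..x N} f" and base: "base_function N x f b"
  shows "\<exists>!g. g \<in> extensional {x 0..x N} \<and> continuous_on {x 0..x N} g \<and> self_referential N x \<alpha> f b g"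
proof -
  obtain g where g: "continuous_on {x 0..x N} g" "self_referential N x \<alpha> f b g"
    using self_referential_exists[OF assms] .
  let ?g = "restrict g {x 0..x N}"
  have "continuous_on {x 0..x N} ?g"
    using g(1) by (rule continuous_on_eq) simp
  moreover have "self_referential N x \<alpha> f b ?g"
    unfolding self_referential_iff
  proof (intro ballI)
    fix i t assume it: "i \<in> {1..N}" "t \<in> {x 0..x N}"
    have "Lmap N x i t \<in> {x 0..x N}"
      using bij_betw_apply[OF bij_betw_Lmap[OF it(1)] it(2)] subinterval_subset[OF it(1)] by blast
    then show "?g (Lmap N x i t) = f (Lmap N x i t) + \<alpha> i * (?g t - b t)"
      using g(2) it by (simp add: self_referential_iff)
  qed
  moreover have "?g \<in> extensional {x 0..x N}" by simp
  ultimately show ?thesis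
  proof (intro ex_ex1I)
    fix g h
    assume "g \<in> extensional {x 0..x N} \<and> continuous_on {x 0..x N} g \<and> self_referential N x \<alpha> f b g"
      and "h \<in> extensional {x 0..x N} \<and> continuous_on {x 0..x N} h \<and> self_referential N x \<alpha> f b h"
    then show "g = h"
      using self_referential_unique[OF \<alpha>, of g f b h] extensionalityI[of g "{x 0..x N}" h] by blast
  qed blast
qed

lemma fractal_function:
  assumes "scale_vector N \<alpha>" "continuous_on {x 0..x N} f" "base_function N x f b"
  shows "continuous_on {x 0..x N} (fractal_function N x \<alpha> f b)"
    and "self_referential N x \<alpha> f b (fractal_function N x \<alpha> f b)"
  using theI'[OF fractal_function_ex1[OF assms]] by (simp_all add: fractal_function_def)

lemma is_attractor_iff:
  assumes \<alpha>: "scale_vector N \<alpha>"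
    and f: "continuous_on {x 0..x N} f" and base: "base_function N x f b"
  shows "is_attractor N x \<alpha> f b A \<longleftrightarrow> A = (\<lambda>t. (t, fractal_function N x \<alpha> f b t)) ` {x 0..x N}"
proof
  let ?g = "fractal_function N x \<alpha> f b"
  let ?W = "ifs_map N x \<alpha> f b"
  let ?G = "(\<lambda>t. (t, ?g t)) ` {x 0..x N}"
  note g = fractal_function[OF assms]
  have W_g: "?W i (t, ?g t) = (Lmap N x i t, ?g (Lmap N x i t))"
    if "i \<in> {1..N}" "t \<in> {x 0..x N}" for i t
    using g(2) that by (simp add: self_referential_iff ifs_map_def algebra_simps)
  have L_img: "Lmap N x i ` {x 0..x N} = {x (i - 1)..x i}" if "i \<in> {1..N}" for i
    using bij_betw_Lmap[OF that] by (simp add: bij_betw_def)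
  have I_eq: "{x 0..x N} = (\<Union>i\<in>{1..N}. Lmap N x i ` {x 0..x N})"
  proof -
    have "(\<Union>i\<in>{1..N}. Lmap N x i ` {x 0..x N}) = (\<Union>i\<in>{1..N}. {x (i - 1)..x i})"
      by (rule SUP_cong[OF refl L_img])
    also have "\<dots> = {x 0..x N}"
    proof (intro equalityI subsetI)
      fix t assume "t \<in> {x 0..x N}"
      then show "t \<in> (\<Union>i\<in>{1..N}. {x (i - 1)..x i})" by (rule subinterval_cover) (rule UN_I)
    qed (use subinterval_subset in blast)
    finally show ?thesis ..
  qed
  {
    assume A: "A = ?G"
    have "compact ?G"
      by (intro compact_continuous_image compact_Icc continuous_intros g(1))
    moreover have "?G = (\<Union>i\<in>{1..N}. ?W i ` ?G)"
    proof -
      have "?W i ` ?G = (\<lambda>t. (t, ?g t)) ` (Lmap N x i ` {x 0..x N})" if "i \<in> {1..N}" for i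
        unfolding image_image using W_g[OF that] by (intro image_cong refl) auto
      then have "(\<Union>i\<in>{1..N}. ?W i ` ?G) = (\<lambda>t. (t, ?g t)) ` (\<Union>i\<in>{1..N}. Lmap N x i ` {x 0..x N})"
        unfolding image_UN by (intro SUP_cong) auto
      then show ?thesis using I_eq by simp
    qed
    ultimately show "is_attractor N x \<alpha> f b A"
      unfolding is_attractor_def A using partition_ends by auto
  next
    assume "is_attractor N x \<alpha> f b A"
    then have ne: "A \<noteq> {}" and cA: "compact A" and sub: "A \<subseteq> {x 0..x N} \<times> UNIV"
      and inv: "A = (\<Union>i\<in>{1..N}. ?W i ` A)" by (auto simp: is_attractor_def)
    have contr: "\<exists>i\<in>{1..N}. \<exists>q\<in>A. p = ?W i q" if "p \<in> A" for p
      using that inv by blast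
    have "continuous_on A (\<lambda>p. ?g (fst p))"
      by (rule continuous_on_compose2[OF g(1)]) (use sub in \<open>auto intro!: continuous_intros\<close>)
    then have "continuous_on A (\<lambda>p. \<bar>snd p - ?g (fst p)\<bar>)" by (intro continuous_intros)
    then obtain p where p: "p \<in> A" "\<And>q. q \<in> A \<Longrightarrow> \<bar>snd q - ?g (fst q)\<bar> \<le> \<bar>snd p - ?g (fst p)\<bar>"
      using continuous_attains_sup[OF cA ne] by blast
    obtain i q where i: "i \<in> {1..N}" and q: "q \<in> A" "p = ?W i q" using contr[OF p(1)] by blast
    have "fst q \<in> {x 0..x N}" using sub q(1) by auto
    then have "snd p - ?g (fst p) = \<alpha> i * (snd q - ?g (fst q))"
      using q(2) W_g[OF i] by (cases q) (auto simp: ifs_map_def algebra_simps)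
    then have "\<bar>snd p - ?g (fst p)\<bar> \<le> \<bar>\<alpha> i\<bar> * \<bar>snd p - ?g (fst p)\<bar>"
      using p(2)[OF q(1)] by (simp add: abs_mult mult_left_mono)
    moreover have "\<bar>\<alpha> i\<bar> < 1" using \<alpha> i by (simp add: scale_vector_def)
    ultimately have "\<bar>snd p - ?g (fst p)\<bar> = 0"
      using mult_strict_right_mono[of "\<bar>\<alpha> i\<bar>" 1 "\<bar>snd p - ?g (fst p)\<bar>"]
      by (cases "snd p = ?g (fst p)") auto
    then have on_graph: "snd q = ?g (fst q)" if "q \<in> A" for q using p(2)[OF that] by simp
    define P where "P = fst ` A"
    have P: "P \<noteq> {}" "closed P"
      using ne cA by (auto simp: P_def intro!: compact_imp_closed compact_continuous_image continuous_intros)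
    have P_L: "Lmap N x i s \<in> P" if "i \<in> {1..N}" "s \<in> P" for i s
    proof -
      obtain q where "q \<in> A" "s = fst q" using \<open>s \<in> P\<close> by (auto simp: P_def)
      moreover have "?W i q \<in> A" using inv \<open>q \<in> A\<close> that(1) by blast
      ultimately show ?thesis by (force simp: P_def ifs_map_def split: prod.splits)
    qed
    have "continuous_on {x 0..x N} (\<lambda>t. infdist t P)" by (intro continuous_intros)
    then obtain t where t: "t \<in> {x 0..x N}" "\<And>s. s \<in> {x 0..x N} \<Longrightarrow> infdist s P \<le> infdist t P"
      using continuous_attains_sup[of "{x 0..x N}" "\<lambda>t. infdist t P"] partition_ends by auto
    obtain j s where j: "j \<in> {1..N}" and s: "s \<in> {x 0..x N}" "t = Lmap N x j s" using t(1) I_eq by blast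
    obtain r where r: "r \<in> P" "infdist s P = dist s r" using infdist_attains_inf[OF P(2,1)] by metis
    have "infdist t P \<le> dist t (Lmap N x j r)" using P_L[OF j r(1)] by (rule infdist_le)
    also have "\<dots> = slope N x j * infdist s P"
      using slope_pos[OF j] by (simp add: s(2) r(2) Lmap_def dist_real_def flip: abs_mult right_diff_distrib)
         (simp add: abs_mult)
    also have "\<dots> \<le> slope N x j * infdist t P"
      using slope_pos[OF j] t(2)[OF s(1)] by (simp add: mult_left_mono)
    finally have "infdist t P = 0"
      using slope_less_1[OF j] mult_strict_right_mono[of "slope N x j" 1 "infdist t P"] infdist_nonneg[of t P]
      by (cases "infdist t P = 0") auto
    then have "s \<in> P" if "s \<in> {x 0..x N}" for s
      using t(2)[OF that] infdist_nonneg[of s P] in_closed_iff_infdist_zero[OF P(2,1)] by auto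
    then have "{x 0..x N} \<subseteq> P" by blast
    then show "A = ?G"
      using on_graph sub by (force simp: P_def image_iff subset_iff)
  }
qed

end

end

theory Submission
  imports Defs
begin

text \<open>
  The reflection \<open>t \<mapsto> - t\<close> conjugates the two iterated function systems, so by uniqueness of the
  self-referential function the flipped fractal function is the reflection of the original one.
\<close>

text \<open>Reversing the index and negating the value each reverse the order, so together they
  preserve it. Truncated subtraction is harmless, as indices stay at most \<open>N\<close>.\<close>

lemma is_partition_flip:
  assumes "is_partition N x"
  shows "is_partition N (flip_partition N x)"
  using assms by (auto simp: is_partition_def strict_mono_on_def flip_partition_def)

lemma flip_partition_ends [simp]:
  "flip_partition N x 0 = - x N" "flip_partition N x N = - x 0"
  by (simp_all add: flip_partition_def)

lemma scale_vector_flip: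
  assumes "scale_vector N \<alpha>"
  shows "scale_vector N (flip_scale N \<alpha>)"
  unfolding scale_vector_def flip_scale_def
proof
  fix i assume "i \<in> {1..N}"
  \<comment> \<open>Scale factors belong to the subintervals, numbered from 1, while points are
    numbered from 0; hence this reversal against \<open>N - i\<close> in
    \<open>flip_partition\<close>.\<close>
  then have "N + 1 - i \<in> {1..N}" by auto
  then show "\<bar>\<alpha> (N + 1 - i)\<bar> < 1" using assms unfolding scale_vector_def by blast
qed

lemma continuous_on_flip_function:
  assumes "continuous_on {a..b} g"
  shows "continuous_on {- b..- a} (flip_function g)"
  unfolding flip_function_def
  by (rule continuous_on_compose2[OF assms]) (auto intro: continuous_intros)

lemma base_function_flip:
  assumes "base_function N x f b"
  shows "base_function N (flip_partition N x) (flip_function f) (flip_function b)"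
  using assms continuous_on_flip_function[of "x 0" "x N" b]
  by (simp add: base_function_def flip_function_def)

text \<open>In the form of \<open>self_referential_iff\<close>, pulled back along the affine maps,
  no inverse map has to be reflected: equation \<open>i\<close> of the flipped system at
  \<open>t\<close> is equation \<open>N + 1 - i\<close> of the original one at
  \<open>- t\<close>.\<close>

lemma self_referential_flip:
  assumes N: "2 \<le> N" and part: "is_partition N x" and g: "self_referential N x \<alpha> f b g"
  shows "self_referential N (flip_partition N x) (flip_scale N \<alpha>)
           (flip_function f) (flip_function b) (flip_function g)"
  unfolding self_referential_iff[OF N is_partition_flip[OF part]]
proof (intro ballI)
  fix i t
  assume i: "i \<in> {1..N}" and t: "t \<in> {flip_partition N x 0..flip_partition N x N}"
  \<comment> \<open>The conjugacy: the flipped map has the slope of its partner and the opposite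
    intercept, so negating its value amounts to negating the partner's argument.\<close>
  have L: "- Lmap N (flip_partition N x) i t = Lmap N x (N + 1 - i) (- t)"
    using Lmap_flip_partition[OF i, of x t] by (simp add: Lmap_def)
  have "N + 1 - i \<in> {1..N}" "- t \<in> {x 0..x N}" using i t by auto
  then have "g (Lmap N x (N + 1 - i) (- t)) =
      f (Lmap N x (N + 1 - i) (- t)) + \<alpha> (N + 1 - i) * (g (- t) - b (- t))"
    using g unfolding self_referential_iff[OF N part] by blast
  then show "flip_function g (Lmap N (flip_partition N x) i t) =
      flip_function f (Lmap N (flip_partition N x) i t) +
      flip_scale N \<alpha> i * (flip_function g t - flip_function b t)"
    by (simp only: flip_function_def flip_scale_def L)
qed

lemma flipped_fractal_function_eq:
  assumes N: "2 \<le> N" and part: "is_partition N x" and \<alpha>: "scale_vector N \<alpha>"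
    and f: "continuous_on {x 0..x N} f" and base: "base_function N x f b"
    and t: "t \<in> {- x N..- x 0}"
  shows "flipped_fractal_function N x \<alpha> f b t = fractal_function N x \<alpha> f b (- t)"
proof -
  let ?y = "flip_partition N x"
  let ?g = "fractal_function N x \<alpha> f b"
  note g = fractal_function[OF N part \<alpha> f base]
  have "continuous_on {?y 0..?y N} (flip_function f)"
    using continuous_on_flip_function[OF f] by simp
  note h = fractal_function[OF N is_partition_flip[OF part] scale_vector_flip[OF \<alpha>] this
      base_function_flip[OF base]]
  have "flipped_fractal_function N x \<alpha> f b t = flip_function ?g t"
    unfolding flipped_fractal_function_def
  \<comment> \<open>Here \<open>h\<close> settles continuity and self-reference of the flipped
    fractal function, which leaves the same two properties of the reflected one.\<close>
  proof (rule self_referential_unique[OF N is_partition_flip[OF part] scale_vector_flip[OF \<alpha>] h])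
    show "continuous_on {?y 0..?y N} (flip_function ?g)"
      using continuous_on_flip_function[OF g(1)] by simp
    show "self_referential N ?y (flip_scale N \<alpha>) (flip_function f) (flip_function b) (flip_function ?g)"
      by (rule self_referential_flip[OF N part g(2)])
    show "t \<in> {?y 0..?y N}" using t by simp
  qed
  then show ?thesis by (simp add: flip_function_def)
qed

theorem theorem4p1:
  fixes N :: nat and x \<alpha> :: "nat \<Rightarrow> real" and f b :: "real \<Rightarrow> real"
  assumes "2 \<le> N"
    and "is_partition N x"
    and "scale_vector N \<alpha>"
    and "continuous_on {x 0..x N} f"
    and "base_function N x f b"
  shows "integral {- x N..- x 0} (flipped_fractal_function N x \<alpha> f b) =
         integral {x 0..x N} (fractal_function N x \<alpha> f b)"
proof -
  have "integral {- x N..- x 0} (flipped_fractal_function N x \<alpha> f b) =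
        integral {- x N..- x 0} (\<lambda>t. fractal_function N x \<alpha> f b (- t))"
    by (rule integral_cong) (rule flipped_fractal_function_eq[OF assms])
  also have "\<dots> = integral {x 0..x N} (fractal_function N x \<alpha> f b)"
    \<comment> \<open>Substitution of \<open>- t\<close> for \<open>t\<close>, valid for any
      integrand.\<close>
    by (rule Henstock_Kurzweil_Integration.integral_reflect_real)
  finally show ?thesis .
qed

end
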